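(* Let $\{k_n\}_{n=0}^\infty$ be a building sequence of the family of random multi-hooking networks $\{G_n\}_{n\ge 1}$ grown from a seed $G_0$ with hook $h$. Let $n\ge 1$ and let $v$ be a node in the graph $G_n$. Conditionally on $G_{n-1}$ and on the choice of the latches $\ell_1,\ldots,\ell_{k_{n-1}}$ in $G_{n-1}$, the eccentricity $C_n(v)$ of $v$ in $G_n$ is given by $$\widetilde C_n(v)=\max\big\{C_{n-1}(v),\; d_v^{\#}+C_0(h)\big\}\qquad\text{if } v\in V_{n-1},$$ and $$\widetilde C_n(v)=\max\Big\{d(v,h)+C_{n-1}(\ell_i),\;\max\big\{C_0(v),\;\big(d(v,h)+d_{\ell_i}^{\#}+C_0(h)\big)\,\mathbb{I}_{\{k_{n-1}>1\}}\big\}\Big\}\qquad\text{if } v\in V_0^{\mathrm{co}_i}.$$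
   Context: Seed. $G_0$ is a connected finite graph (loops and multiple edges are allowed) with $\tau_0\ge 2$ vertices, one of which is designated as the hook $h$. Building sequence. A sequence of integers $\{k_n\}_{n=0}^\infty$ with $k_n\ge 1$ is a building sequence (for a seed of order $\tau_0$) if: (i) $k_n\le \tau_0+(\tau_0-1)\sum_{i=0}^{n-1}k_i$ for all $n\ge 0$; (ii) the limit $a:=\lim_{n\to\infty} k_n/\sum_{i=0}^n k_i$ exists in $[0,1]$; (iii) the limit $b:=\lim_{n\to\infty}\tau_0/k_n\ge 0$ exists. Random multi-hooking network. For $n\ge 1$, given $G_{n-1}=(V_{n-1},\mathcal{E}_{n-1})$, a set $\mathbb{L}_{n-1}=\{\ell_1,\ldots,\ell_{k_{n-1}}\}$ of $k_{n-1}$ distinct vertices of $G_{n-1}$, called latches, is chosen uniformly at random among all subsets of $V_{n-1}$ of size $k_{n-1}$ (given the whole past). For each latch $\ell_i$ a fresh copy of the seed (the $i$th copy) is taken and its hook is fused (identified) with $\ell_i$; distinct latches receive distinct copies. The result is $G_n$, with vertex set $V_n$. Notation. The distance between two vertices is the number of edges on a shortest path joining them. $C_m(u)$ is the eccentricity of a vertex $u$ in $G_m$, i.e., the maximum distance in $G_m$ from $u$ to a vertex of $G_m$. $\widetilde C_n(v)=C_n(v)\mid G_{n-1},\mathbb{L}_{n-1}$ is the eccentricity of $v$ in $G_n$ given $G_{n-1}$ and the latches. For $v\in V_{n-1}$, $d_v^{\#}=\max_{\ell_j\in\mathbb{L}_{n-1}}d(v,\ell_j)$, with distances in $G_{n-1}$.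 The notation $v\in V_0^{\mathrm{co}_i}$ means that $v$ is a vertex of $G_n$ belonging to the $i$th copy of the seed, latched at $\ell_i$; otherwise $v\in V_{n-1}$. For $v\in V_0^{\mathrm{co}_i}$, $d(v,h)$ is the distance within that copy from $v$ to the copy's hook, and $C_0(v)$ is the eccentricity in the seed $G_0$ of the vertex corresponding to $v$. $\mathbb{I}_{\{k_{n-1}>1\}}$ is $1$ if $k_{n-1}>1$ and $0$ otherwise. *)

theory Defs
  imports "HOL-Probability.Probability_Mass_Function"
begin

(* Undirected multigraphs: every edge carries its set of end points, which is a singleton for a
   loop; parallel edges are distinct edges with the same end points. *)
record ('v, 'e) multigraph =
  verts :: "'v set"
  edges :: "'e set"
  ends :: "'e \<Rightarrow> 'v set"

definition finite_multigraph :: "('v, 'e) multigraph \<Rightarrow> bool" where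
  "finite_multigraph G \<longleftrightarrow> finite (verts G) \<and> finite (edges G) \<and>
     (\<forall>e\<in>edges G. ends G e \<subseteq> verts G \<and> card (ends G e) \<in> {1, 2})"

definition gpath :: "('v, 'e) multigraph \<Rightarrow> 'v list \<Rightarrow> 'e list \<Rightarrow> bool" where
  "gpath G vs es \<longleftrightarrow>
     length vs = Suc (length es) \<and> distinct vs \<and> set vs \<subseteq> verts G \<and> set es \<subseteq> edges G \<and>
     (\<forall>i<length es. ends G (es ! i) = {vs ! i, vs ! Suc i})"

definition joins :: "('v, 'e) multigraph \<Rightarrow> 'v \<Rightarrow> 'v list \<Rightarrow> 'e list \<Rightarrow> 'v \<Rightarrow> bool" where
  "joins G u vs es w \<longleftrightarrow> gpath G vs es \<and> hd vs = u \<and> last vs = w"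

definition gconnected :: "('v, 'e) multigraph \<Rightarrow> bool" where
  "gconnected G \<longleftrightarrow> (\<forall>u\<in>verts G. \<forall>w\<in>verts G. \<exists>vs es. joins G u vs es w)"

definition gdist :: "('v, 'e) multigraph \<Rightarrow> 'v \<Rightarrow> 'v \<Rightarrow> nat" where
  "gdist G u w = (LEAST d. \<exists>vs es. joins G u vs es w \<and> length es = d)"

definition ecc :: "('v, 'e) multigraph \<Rightarrow> 'v \<Rightarrow> nat" where
  "ecc G u = (MAX w\<in>verts G. gdist G u w)"

definition max_latch_dist :: "('v, 'e) multigraph \<Rightarrow> 'v set \<Rightarrow> 'v \<Rightarrow> nat" where
  "max_latch_dist G L v = (MAX l\<in>L. gdist G v l)"

definition seed :: "('s, 'e) multigraph \<Rightarrow> 's \<Rightarrow> bool" where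
  "seed S h \<longleftrightarrow> finite_multigraph S \<and> gconnected S \<and> card (verts S) \<ge> 2 \<and> h \<in> verts S"

definition building_sequence :: "nat \<Rightarrow> (nat \<Rightarrow> nat) \<Rightarrow> bool" where
  "building_sequence \<tau> k \<longleftrightarrow>
     (\<forall>n. k n \<ge> 1) \<and>
     (\<forall>n. k n \<le> \<tau> + (\<tau> - 1) * (\<Sum>i<n. k i)) \<and>
     (\<exists>a\<in>{0..1::real}. (\<lambda>n. real (k n) / real (\<Sum>i\<le>n. k i)) \<longlonglongrightarrow> a) \<and>
     (\<exists>b\<ge>0::real. (\<lambda>n. real \<tau> / real (k n)) \<longlonglongrightarrow> b)"

(* Names for the vertices and edges of all the networks G_0, G_1, ...: Copy n l x is the vertex x
   of the copy of the seed hooked at the latch l in passing from G_n to G_(n+1). The time stamp n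
   is needed because a vertex can serve as a latch several times. The hook of a copy gets no name
   of its own, as it is identified with the latch. *)
datatype 's node = Orig 's | Copy nat "'s node" 's

datatype ('s, 'e) link = Orig_link 'e | Copy_link nat "'s node" 'e

type_synonym ('s, 'e) network = "('s node, ('s, 'e) link) multigraph"

definition initial :: "('s, 'e) multigraph \<Rightarrow> ('s, 'e) network" where
  "initial S =
     \<lparr>verts = Orig ` verts S, edges = Orig_link ` edges S,
      ends = (\<lambda>e. case e of Orig_link e' \<Rightarrow> Orig ` ends S e' | Copy_link _ _ _ \<Rightarrow> {})\<rparr>"

definition fuse :: "nat \<Rightarrow> 's \<Rightarrow> 's node \<Rightarrow> 's \<Rightarrow> 's node" where
  "fuse n h l x = (if x = h then l else Copy n l x)"

definition seed_copy ::
    "nat \<Rightarrow> ('s, 'e) multigraph \<Rightarrow> 's \<Rightarrow> 's node \<Rightarrow> ('s, 'e) network" where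
  "seed_copy n S h l =
     \<lparr>verts = fuse n h l ` verts S, edges = Copy_link n l ` edges S,
      ends = (\<lambda>e. case e of Orig_link _ \<Rightarrow> {} | Copy_link _ _ e' \<Rightarrow> fuse n h l ` ends S e')\<rparr>"

definition attach ::
    "nat \<Rightarrow> ('s, 'e) multigraph \<Rightarrow> 's \<Rightarrow> ('s, 'e) network \<Rightarrow> 's node set \<Rightarrow> ('s, 'e) network" where
  "attach n S h G L =
     \<lparr>verts = verts G \<union> (\<Union>l\<in>L. verts (seed_copy n S h l)),
      edges = edges G \<union> (\<Union>l\<in>L. edges (seed_copy n S h l)),
      ends = (\<lambda>e. case e of
                Orig_link _ \<Rightarrow> ends G e
              | Copy_link m l _ \<Rightarrow> if m = n then ends (seed_copy n S h l) e else ends G e)\<rparr>"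

definition latch_pmf :: "(nat \<Rightarrow> nat) \<Rightarrow> nat \<Rightarrow> ('s, 'e) network \<Rightarrow> 's node set pmf" where
  "latch_pmf k n G = pmf_of_set {L. L \<subseteq> verts G \<and> card L = k n}"

(* The law of G_n. The latches chosen in G_n depend on the past only through G_n, so the networks
   form a Markov chain. *)
primrec network_pmf ::
    "('s, 'e) multigraph \<Rightarrow> 's \<Rightarrow> (nat \<Rightarrow> nat) \<Rightarrow> nat \<Rightarrow> ('s, 'e) network pmf" where
  "network_pmf S h k 0 = return_pmf (initial S)"
| "network_pmf S h k (Suc n) =
     bind_pmf (network_pmf S h k n) (\<lambda>G. map_pmf (attach n S h G) (latch_pmf k n G))"

(* The joint law of G_n, the set of latches chosen in G_n, and G_(n+1). *)
definition step_pmf ::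
    "('s, 'e) multigraph \<Rightarrow> 's \<Rightarrow> (nat \<Rightarrow> nat) \<Rightarrow> nat \<Rightarrow>
     (('s, 'e) network \<times> 's node set \<times> ('s, 'e) network) pmf" where
  "step_pmf S h k n =
     bind_pmf (network_pmf S h k n)
       (\<lambda>G. map_pmf (\<lambda>L. (G, L, attach n S h G L)) (latch_pmf k n G))"

definition past_event ::
    "('s, 'e) network \<Rightarrow> 's node set \<Rightarrow> (('s, 'e) network \<times> 's node set \<times> ('s, 'e) network) set" where
  "past_event G L = {(G', L', H). G' = G \<and> L' = L}"

(* For n >= 1, the conditional law of the eccentricity of v in G_n, given that G_(n-1) is G and
   that the set of latches chosen in it is L. *)
definition cond_ecc_pmf ::
    "('s, 'e) multigraph \<Rightarrow> 's \<Rightarrow> (nat \<Rightarrow> nat) \<Rightarrow> nat \<Rightarrow>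
     ('s, 'e) network \<Rightarrow> 's node set \<Rightarrow> 's node \<Rightarrow> nat pmf" where
  "cond_ecc_pmf S h k n G L v =
     map_pmf (\<lambda>(_, _, H). ecc H v) (cond_pmf (step_pmf S h k (n - 1)) (past_event G L))"

end

theory Submission imports Defs begin

(* Every vertex of G_n lies in G_(n-1) or in a copy of the seed that meets the rest of G_n only in
   its latch, so all distances in G_n are sums of distances in G_(n-1) and in the seed. The upper
   bounds are triangle inequalities; the lower bounds hold because the claimed distance from a fixed
   vertex changes by at most one along every edge of G_n. The eccentricities are then maxima of
   these sums, and the conditional law is a point mass because G_n is a function of G_(n-1) and
   the latches. *)

section \<open>Distances via walks\<close>

text \<open>Passing to a relation makes walks of length \<open>d\<close> relational powers
  \<open>adj G ^^ d\<close> and connectedness a matter of \<open>rtrancl\<close>, so that walks can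
  be concatenated without checking that vertices are distinct.\<close>

definition adj :: "('v, 'e) multigraph \<Rightarrow> ('v \<times> 'v) set" where
  "adj G = {(u, w). u \<in> verts G \<and> w \<in> verts G \<and> (\<exists>e\<in>edges G. ends G e = {u, w})}"

lemma adj_verts: "(u, w) \<in> adj G \<Longrightarrow> u \<in> verts G \<and> w \<in> verts G"
  by (simp add: adj_def)

lemma sym_adj: "sym (adj G)"
  by (auto simp: adj_def sym_def insert_commute)

lemma joins_imp_walk:
  assumes "joins G u vs es w"
  shows "(u, w) \<in> adj G ^^ length es"
proof -
  have len: "length vs = Suc (length es)" and V: "set vs \<subseteq> verts G" and E: "set es \<subseteq> edges G"
    and ends: "\<And>i. i < length es \<Longrightarrow> ends G (es ! i) = {vs ! i, vs ! Suc i}"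
    and "hd vs = u" "last vs = w"
    using assms by (auto simp: joins_def gpath_def)
  have "vs \<noteq> []"
    using len by auto
  then have "vs ! 0 = u" "vs ! length es = w"
    using len \<open>hd vs = u\<close> \<open>last vs = w\<close> by (simp_all add: hd_conv_nth last_conv_nth)
  moreover have "(vs ! i, vs ! Suc i) \<in> adj G" if "i < length es" for i
  proof -
    have "vs ! i \<in> set vs" "vs ! Suc i \<in> set vs" "es ! i \<in> set es"
      using that len by auto
    then show ?thesis
      using V E ends[OF that] by (auto simp: adj_def)
  qed
  ultimately show ?thesis
    unfolding relpow_fun_conv by blast
qed

text \<open>Loop erasure: walks may repeat vertices, paths in \<open>joins\<close> may not. The
  first vertex of the walk is put in front of a path for the rest; if it already occurs there, the
  path is cut instead.\<close>

lemma walk_imp_joins: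
  assumes "(u, w) \<in> adj G ^^ d" "u \<in> verts G"
  shows "\<exists>vs es. joins G u vs es w \<and> length es \<le> d"
  using assms
proof (induction d arbitrary: u)
  case 0
  then have "joins G u [u] [] w"
    by (auto simp: joins_def gpath_def)
  then show ?case by fastforce
next
  case (Suc d)
  then obtain y where uy: "(u, y) \<in> adj G" and yw: "(y, w) \<in> adj G ^^ d"
    by (meson relpow_Suc_D2)
  then obtain vs es where p: "joins G y vs es w" and le: "length es \<le> d"
    using Suc.IH adj_verts by metis
  have len: "length vs = Suc (length es)" and dis: "distinct vs"
    and V: "set vs \<subseteq> verts G" and E: "set es \<subseteq> edges G"
    and ends: "\<And>i. i < length es \<Longrightarrow> ends G (es ! i) = {vs ! i, vs ! Suc i}"
    and hd: "hd vs = y" and last: "last vs = w"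
    using p by (auto simp: joins_def gpath_def)
  show ?case
  proof (cases "u \<in> set vs")
    case True
    then obtain i where i: "i < length vs" "vs ! i = u"
      by (auto simp: in_set_conv_nth)
    \<comment> \<open>The part of the path before its visit to \<open>u\<close> is a detour; what
      remains is still a path and is no longer than before.\<close>
    have "joins G u (drop i vs) (drop i es) w"
      using i len dis V E ends last
      by (auto simp: joins_def gpath_def hd_drop_conv_nth last_drop
          dest: in_set_dropD)
    then show ?thesis
      using le by (intro exI conjI) auto
  next
    case False
    obtain e where e: "e \<in> edges G" "ends G e = {u, y}"
      using uy by (auto simp: adj_def)
    have "vs \<noteq> []"
      using len by auto
    moreover from this have "vs ! 0 = y"
      using hd by (simp add: hd_conv_nth)
    ultimately have "\<forall>i<length (e # es). ends G ((e # es) ! i) = {(u # vs) ! i, (u # vs) ! Suc i}"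
      using ends e by (auto simp: less_Suc_eq_0_disj)
    then have "joins G u (u # vs) (e # es) w"
      using False len dis V E last e Suc.prems \<open>vs \<noteq> []\<close>
      by (auto simp: joins_def gpath_def)
    then show ?thesis
      using le by (intro exI conjI) auto
  qed
qed

lemma gconnected_iff:
  "gconnected G \<longleftrightarrow> (\<forall>u\<in>verts G. \<forall>w\<in>verts G. (u, w) \<in> (adj G)\<^sup>*)"
proof -
  have "(\<exists>vs es. joins G u vs es w) \<longleftrightarrow> (u, w) \<in> (adj G)\<^sup>*" if "u \<in> verts G" for u w
    using joins_imp_walk walk_imp_joins[OF _ that]
    by (fast intro: relpow_imp_rtrancl dest: rtrancl_imp_relpow)
  then show ?thesis
    unfolding gconnected_def by blast
qed

text \<open>Upper bounds on distances may thus come from arbitrary walks, although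
  \<open>gdist\<close> minimises over paths.\<close>

lemma gdist_le:
  assumes "(u, w) \<in> adj G ^^ d" "u \<in> verts G"
  shows "gdist G u w \<le> d"
proof -
  obtain vs es where "joins G u vs es w" "length es \<le> d"
    using walk_imp_joins[OF assms] by blast
  then show ?thesis
    unfolding gdist_def by (intro order_trans[OF Least_le]) auto
qed

text \<open>Connectedness ensures that \<open>LEAST\<close> ranges over a nonempty set and is
  attained.\<close>

lemma gdist_walk:
  assumes "gconnected G" "u \<in> verts G" "w \<in> verts G"
  shows "(u, w) \<in> adj G ^^ gdist G u w"
proof -
  have "\<exists>d vs es. joins G u vs es w \<and> length es = d"
    using assms by (auto simp: gconnected_def)
  then have "\<exists>vs es. joins G u vs es w \<and> length es = gdist G u w"
    unfolding gdist_def by (rule LeastI_ex)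
  then show ?thesis
    by (metis joins_imp_walk)
qed

lemma gdist_refl: "u \<in> verts G \<Longrightarrow> gdist G u u = 0"
  using gdist_le[of u u 0 G] by simp

lemma gdist_triangle:
  assumes "gconnected G" "u \<in> verts G" "v \<in> verts G" "w \<in> verts G"
  shows "gdist G u w \<le> gdist G u v + gdist G v w"
  using assms gdist_walk[of G u v] gdist_walk[of G v w]
  by (intro gdist_le) (auto simp: relpow_add)

lemma gdist_adj:
  assumes "gconnected G" "u \<in> verts G" "(x, y) \<in> adj G"
  shows "gdist G u y \<le> gdist G u x + 1"
  using gdist_triangle[of G u x y] gdist_le[of x y 1 G] adj_verts[OF assms(3)] assms by simp

text \<open>A potential that rises by at most one per edge rises by at most \<open>d\<close> along a
  walk of length \<open>d\<close>; apply this to a shortest walk. Later \<open>f\<close> is the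
  conjectured distance from \<open>u\<close>.\<close>

lemma gdist_lower_bound:
  fixes f :: "'v \<Rightarrow> nat"
  assumes "gconnected G" "u \<in> verts G" "w \<in> verts G"
    and lip: "\<And>x y. (x, y) \<in> adj G \<Longrightarrow> f y \<le> f x + 1"
  shows "f w \<le> f u + gdist G u w"
proof -
  have "f y \<le> f u + d" if "(u, y) \<in> adj G ^^ d" for d y
    using that by (induction d arbitrary: y) (fastforce dest: lip)+
  then show ?thesis
    using gdist_walk[OF assms(1-3)] by blast
qed

section \<open>Walks under graph homomorphisms\<close>

lemma walk_image:
  assumes "(u, w) \<in> adj G ^^ d"
    and "\<And>x y. (x, y) \<in> adj G \<Longrightarrow> (f x, f y) \<in> adj H"
  shows "(f u, f w) \<in> adj H ^^ d"
  using assms(1)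
proof (induction d arbitrary: w)
  case (Suc d)
  from Suc.prems obtain y where "(u, y) \<in> adj G ^^ d" "(y, w) \<in> adj G"
    by (rule relpow_Suc_E)
  with Suc.IH assms(2) show ?case
    by (blast intro: relpow_Suc_I)
qed simp

text \<open>Homomorphisms do not increase distances, as they map a shortest walk to a walk of the
  same length.\<close>

lemma gdist_image_le:
  assumes "gconnected G" "u \<in> verts G" "w \<in> verts G" "f u \<in> verts H"
    and "\<And>x y. (x, y) \<in> adj G \<Longrightarrow> (f x, f y) \<in> adj H"
  shows "gdist H (f u) (f w) \<le> gdist G u w"
  using walk_image[OF gdist_walk[OF assms(1-3)] assms(5)] assms(4) by (rule gdist_le)

lemma rtrancl_image:
  assumes "(u, w) \<in> (adj G)\<^sup>*"
    and "\<And>x y. (x, y) \<in> adj G \<Longrightarrow> (f x, f y) \<in> adj H"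
  shows "(f u, f w) \<in> (adj H)\<^sup>*"
proof -
  obtain d where "(u, w) \<in> adj G ^^ d"
    using assms(1) by (auto simp: rtrancl_power)
  from walk_image[OF this assms(2)] show ?thesis
    by (rule relpow_imp_rtrancl)
qed

section \<open>Eccentricities as attained maxima\<close>

lemma gdist_le_ecc: "finite (verts G) \<Longrightarrow> w \<in> verts G \<Longrightarrow> gdist G u w \<le> ecc G u"
  unfolding ecc_def by simp

lemma ecc_witness:
  assumes "finite (verts G)" "verts G \<noteq> {}"
  obtains w where "w \<in> verts G" "ecc G u = gdist G u w"
proof -
  have "ecc G u \<in> gdist G u ` verts G"
    unfolding ecc_def using assms by (intro Max_in) auto
  then obtain w where "ecc G u = gdist G u w" "w \<in> verts G"
    by (rule imageE)
  then show ?thesis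
    using that by blast
qed

lemma gdist_le_max_latch_dist: "finite L \<Longrightarrow> w \<in> L \<Longrightarrow> gdist G u w \<le> max_latch_dist G L u"
  unfolding max_latch_dist_def by simp

lemma max_latch_dist_witness:
  assumes "finite L" "L \<noteq> {}"
  obtains w where "w \<in> L" "max_latch_dist G L u = gdist G u w"
proof -
  have "max_latch_dist G L u \<in> gdist G u ` L"
    unfolding max_latch_dist_def using assms by (intro Max_in) auto
  then obtain w where "max_latch_dist G L u = gdist G u w" "w \<in> L"
    by (rule imageE)
  then show ?thesis
    using that by blast
qed

lemma eccI:
  assumes "finite (verts G)"
    and "\<And>w. w \<in> verts G \<Longrightarrow> gdist G u w \<le> m" and "\<exists>w\<in>verts G. gdist G u w \<ge> m"
  shows "ecc G u = m"
  unfolding ecc_def using assms by (intro Max_eqI) (auto intro: antisym)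

lemma ex_ge_max:
  fixes a b :: nat
  assumes "\<exists>w\<in>A. f w \<ge> a" "\<exists>w\<in>A. f w \<ge> b"
  shows "\<exists>w\<in>A. f w \<ge> max a b"
  using assms by (auto simp: max_def)

section \<open>Attaching copies of the seed\<close>

text \<open>Together with \<open>seed_vertex\<close> this gives coordinates on the enlarged network:
  \<open>latch_of\<close> retracts every new copy onto its latch, while \<open>seed_vertex\<close>
  folds all copies onto the seed and collapses the old network to the hook.\<close>

fun latch_of :: "nat \<Rightarrow> 's node \<Rightarrow> 's node" where
  "latch_of n (Orig s) = Orig s"
| "latch_of n (Copy m l x) = (if m = n then l else Copy m l x)"

fun seed_vertex :: "nat \<Rightarrow> 's \<Rightarrow> 's node \<Rightarrow> 's" where
  "seed_vertex n h (Orig s) = h"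
| "seed_vertex n h (Copy m l x) = (if m = n then x else h)"

text \<open>Here \<open>n\<close> is the stamp of the copies about to be attached. All stamps in
  \<open>G\<close> are smaller, so new names never clash with old ones and each copy meets
  \<open>G\<close> in its latch only.\<close>

locale attachment =
  fixes S :: "('s, 'e) multigraph" and h :: 's and n :: nat
    and G :: "('s, 'e) network" and L :: "'s node set"
  assumes seed: "seed S h"
    and finite_G: "finite_multigraph G"
    and connected_G: "gconnected G"
    and fresh_verts: "Copy m l x \<in> verts G \<Longrightarrow> m < n"
    and fresh_edges: "Copy_link m l e \<in> edges G \<Longrightarrow> m < n"
    and latches: "L \<subseteq> verts G" "L \<noteq> {}"
begin

abbreviation "H \<equiv> attach n S h G L"

lemma hook: "h \<in> verts S" and connected_S: "gconnected S"
  and finite_S: "finite_multigraph S"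
  using seed by (auto simp: seed_def)

lemma finite_verts: "finite (verts S)" "finite (verts G)" "finite L"
  using finite_S finite_G latches by (auto simp: finite_multigraph_def intro: finite_subset)

lemma verts_attach: "verts H = verts G \<union> (\<Union>l\<in>L. fuse n h l ` verts S)"
  by (simp add: attach_def seed_copy_def)

lemma latch_in: "l \<in> L \<Longrightarrow> l \<in> verts G"
  using latches by auto

lemma latch_of_old: "v \<in> verts G \<Longrightarrow> latch_of n v = v"
  and seed_vertex_old: "v \<in> verts G \<Longrightarrow> seed_vertex n h v = h"
  by (cases v; auto dest: fresh_verts)+

text \<open>For the hook, \<open>fuse\<close> returns the latch itself, an old vertex whose
  coordinates are itself and \<open>h\<close>; otherwise the stamp \<open>n\<close> triggers the
  second clauses.\<close>

lemma latch_of_fuse: "l \<in> L \<Longrightarrow> latch_of n (fuse n h l x) = l"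
  and seed_vertex_fuse: "l \<in> L \<Longrightarrow> seed_vertex n h (fuse n h l x) = x"
  using latch_of_old seed_vertex_old latch_in by (auto simp: fuse_def)

lemma seed_vertex_in: "z \<in> verts H \<Longrightarrow> seed_vertex n h z \<in> verts S"
  using hook by (auto simp: verts_attach seed_vertex_old seed_vertex_fuse)

lemma fuse_latch_of:
  assumes "z \<in> verts H"
  shows "fuse n h (latch_of n z) (seed_vertex n h z) = z"
proof (cases "z \<in> verts G")
  case True
  then show ?thesis
    by (simp add: latch_of_old seed_vertex_old fuse_def)
next
  case False
  then obtain l x where "l \<in> L" "z = fuse n h l x"
    using assms by (auto simp: verts_attach)
  then show ?thesis
    by (simp add: latch_of_fuse seed_vertex_fuse)
qed

section \<open>Edges and adjacency in the enlarged network\<close>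

lemma edges_attach: "edges H = edges G \<union> (\<Union>l\<in>L. Copy_link n l ` edges S)"
  by (simp add: attach_def seed_copy_def)

lemma ends_attach_old: "e \<in> edges G \<Longrightarrow> ends H e = ends G e"
  by (cases e) (auto simp: attach_def dest: fresh_edges)

lemma ends_attach_new: "ends H (Copy_link n l e) = fuse n h l ` ends S e"
  by (simp add: attach_def seed_copy_def)

lemma adj_attach_old:
  assumes "(x, y) \<in> adj G"
  shows "(x, y) \<in> adj H"
proof -
  obtain e where "x \<in> verts G" "y \<in> verts G" "e \<in> edges G" "ends G e = {x, y}"
    using assms by (auto simp: adj_def)
  moreover from this have "ends H e = {x, y}" "e \<in> edges H"
    by (simp_all add: ends_attach_old edges_attach)
  ultimately show ?thesis
    unfolding adj_def verts_attach by blast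
qed

lemma adj_seed_copy:
  assumes "(x, y) \<in> adj S"
  shows "(fuse n h l x, fuse n h l y) \<in> adj (seed_copy n S h l)"
proof -
  obtain e where "x \<in> verts S" "y \<in> verts S" "e \<in> edges S" "ends S e = {x, y}"
    using assms by (auto simp: adj_def)
  then show ?thesis
    by (auto simp: adj_def seed_copy_def intro!: bexI[of _ "Copy_link n l e"])
qed

lemma adj_seed_copy_attach:
  assumes "l \<in> L" "(x, y) \<in> adj (seed_copy n S h l)"
  shows "(x, y) \<in> adj H"
proof -
  obtain e where "x \<in> fuse n h l ` verts S" "y \<in> fuse n h l ` verts S"
    and "e \<in> edges S" "fuse n h l ` ends S e = {x, y}"
    using assms(2) by (auto simp: adj_def seed_copy_def)
  moreover from this assms(1) have "Copy_link n l e \<in> edges H"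
    by (auto simp: edges_attach)
  ultimately show ?thesis
    using assms(1) ends_attach_new[of l e] unfolding adj_def verts_attach by blast
qed

lemma adj_attach_new: "l \<in> L \<Longrightarrow> (x, y) \<in> adj S \<Longrightarrow> (fuse n h l x, fuse n h l y) \<in> adj H"
  using adj_seed_copy adj_seed_copy_attach by blast

lemma inj_fuse: "l \<in> L \<Longrightarrow> inj (fuse n h l)"
  by (metis injI seed_vertex_fuse)

text \<open>No edge runs between different pieces: each lies in the old network or inside a single
  copy. This is what makes the latches cut vertices.\<close>

lemma adj_attach_cases:
  assumes "(x, y) \<in> adj H"
  obtains (old) "(x, y) \<in> adj G"
  | (new) l p q where "l \<in> L" "(p, q) \<in> adj S" "x = fuse n h l p" "y = fuse n h l q"
proof -
  obtain e where e: "e \<in> edges H" "ends H e = {x, y}"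
    using assms by (auto simp: adj_def)
  then consider "e \<in> edges G" | l e' where "l \<in> L" "e' \<in> edges S" "e = Copy_link n l e'"
    by (auto simp: edges_attach)
  then show ?thesis
  proof cases
    case 1
    then have "(x, y) \<in> adj G"
      using e(2) finite_G ends_attach_old[OF 1] by (auto simp: adj_def finite_multigraph_def)
    then show ?thesis by (rule old)
  next
    case 2
    then have im: "fuse n h l ` ends S e' = {x, y}"
      using e by (simp add: ends_attach_new)
    then have "x \<in> fuse n h l ` ends S e'" "y \<in> fuse n h l ` ends S e'"
      by simp_all
    then obtain p q where pq: "p \<in> ends S e'" "q \<in> ends S e'" "x = fuse n h l p" "y = fuse n h l q"
      by blast
    \<comment> \<open>Injectivity of \<open>fuse\<close> pulls the end points back to the seed, for
      loops as well as for proper edges.\<close>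
    then have "fuse n h l ` ends S e' = fuse n h l ` {p, q}"
      using im by simp
    then have "ends S e' = {p, q}"
      by (simp only: inj_image_eq_iff[OF inj_fuse[OF 2(1)]])
    moreover have "ends S e' \<subseteq> verts S"
      using finite_S 2 by (simp add: finite_multigraph_def)
    ultimately have "(p, q) \<in> adj S"
      using 2 by (auto simp: adj_def)
    then show ?thesis
      using new 2 pq by blast
  qed
qed

section \<open>Invariants preserved by attaching copies\<close>

lemma connected_attach: "gconnected H"
proof -
  obtain l0 where l0: "l0 \<in> L"
    using latches by blast
  have old: "(u, w) \<in> (adj H)\<^sup>*" if "u \<in> verts G" "w \<in> verts G" for u w
    using rtrancl_mono[OF subrelI[OF adj_attach_old]] connected_G that
    by (auto simp: gconnected_iff)
  \<comment> \<open>Every vertex is reached from one fixed latch, first through the old network and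
    then through a copy; symmetry then joins any two vertices.\<close>
  have "(l0, z) \<in> (adj H)\<^sup>*" if "z \<in> verts H" for z
  proof (cases "z \<in> verts G")
    case False
    then obtain l x where z: "l \<in> L" "x \<in> verts S" "z = fuse n h l x"
      using \<open>z \<in> verts H\<close> by (auto simp: verts_attach)
    have "(h, x) \<in> (adj S)\<^sup>*"
      using connected_S hook z(2) by (simp add: gconnected_iff)
    from rtrancl_image[where f = "fuse n h l", OF this adj_attach_new[OF z(1)]]
    have "(l, z) \<in> (adj H)\<^sup>*"
      by (simp add: fuse_def z(3))
    with old[OF latch_in[OF l0] latch_in[OF z(1)]] show ?thesis
      by (rule rtrancl_trans)
  qed (use old l0 latch_in in blast)
  then have "(u, w) \<in> (adj H)\<^sup>*" if "u \<in> verts H" "w \<in> verts H" for u w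
    using that by (meson rtrancl_trans symD sym_adj sym_rtrancl)
  then show ?thesis
    by (simp add: gconnected_iff)
qed

lemma finite_attach: "finite_multigraph H"
proof -
  have "finite (verts H)" "finite (edges H)"
    using finite_verts finite_S finite_G
    by (auto simp: verts_attach edges_attach finite_multigraph_def)
  moreover have "ends H e \<subseteq> verts H \<and> card (ends H e) \<in> {1, 2}" if "e \<in> edges H" for e
  proof (cases "e \<in> edges G")
    case True
    then show ?thesis
      using finite_G by (auto simp: ends_attach_old verts_attach finite_multigraph_def)
  next
    case False
    then obtain l e' where e: "l \<in> L" "e' \<in> edges S" "e = Copy_link n l e'"
      using \<open>e \<in> edges H\<close> by (auto simp: edges_attach)
    then have "ends H e = fuse n h l ` ends S e'"
      by (simp add: ends_attach_new)
    moreover have "card (fuse n h l ` ends S e') = card (ends S e')"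
      using inj_fuse[OF e(1)] by (meson card_image inj_on_subset subset_UNIV)
    moreover have "ends S e' \<subseteq> verts S" "card (ends S e') \<in> {1, 2}"
      using e finite_S by (auto simp: finite_multigraph_def)
    ultimately show ?thesis
      using e(1) by (simp add: verts_attach) blast
  qed
  ultimately show ?thesis
    by (auto simp: finite_multigraph_def)
qed

text \<open>Every copy contributes its non-hook vertices, whose names are distinct and new. The
  count later shows that enough vertices are available as latches.\<close>

lemma card_attach: "card (verts H) = card (verts G) + (card (verts S) - 1) * card L"
proof -
  have img: "verts H = verts G \<union> (\<lambda>(l, x). Copy n l x) ` (L \<times> (verts S - {h}))"
    using latch_in hook by (fastforce simp: verts_attach fuse_def)
  have "card (verts H) = card (verts G) + card ((\<lambda>(l, x). Copy n l x) ` (L \<times> (verts S - {h})))"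
    unfolding img using fresh_verts finite_verts
    by (intro card_Un_disjoint) auto
  also have "card ((\<lambda>(l, x). Copy n l x) ` (L \<times> (verts S - {h}))) = card (L \<times> (verts S - {h}))"
    by (intro card_image) (auto simp: inj_on_def)
  also have "\<dots> = (card (verts S) - 1) * card L"
    using hook finite_verts by (simp add: card_cartesian_product)
  finally show ?thesis .
qed

lemma fresh_attach:
  "Copy m l x \<in> verts H \<Longrightarrow> m < Suc n" "Copy_link m l e \<in> edges H \<Longrightarrow> m < Suc n"
  by (auto simp: verts_attach edges_attach fuse_def less_Suc_eq split: if_splits
      dest: fresh_verts fresh_edges latch_in)

section \<open>Distances in the enlarged network\<close>

lemma gdist_attach_old_le:
  assumes "u \<in> verts G" "w \<in> verts G"
  shows "gdist H u w \<le> gdist G u w"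
  using gdist_image_le[of G u w "\<lambda>x. x" H] assms connected_G adj_attach_old
  by (auto simp: verts_attach)

lemma gdist_attach_new_le:
  assumes "l \<in> L" "x \<in> verts S" "y \<in> verts S"
  shows "gdist H (fuse n h l x) (fuse n h l y) \<le> gdist S x y"
  using assms connected_S adj_attach_new
  by (intro gdist_image_le) (auto simp: verts_attach)

text \<open>A copy can only be entered through its latch, so the two coordinates contribute
  separately. For an old \<open>z\<close> the second summand is 0.\<close>

lemma gdist_attach_from_old:
  assumes "u \<in> verts G" "z \<in> verts H"
  shows "gdist H u z = gdist G u (latch_of n z) + gdist S h (seed_vertex n h z)"
proof (rule antisym)
  show "gdist H u z \<le> gdist G u (latch_of n z) + gdist S h (seed_vertex n h z)"
  proof (cases "z \<in> verts G")
    case True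
    then show ?thesis
      using gdist_attach_old_le assms by (simp add: latch_of_old trans_le_add1)
  next
    case False
    then obtain l x where z: "l \<in> L" "x \<in> verts S" "z = fuse n h l x"
      using assms by (auto simp: verts_attach)
    have "gdist H u z \<le> gdist H u l + gdist H l z"
      using assms z latch_in connected_attach by (intro gdist_triangle) (auto simp: verts_attach)
    also have "gdist H u l \<le> gdist G u l"
      using gdist_attach_old_le assms latch_in z by blast
    also have "gdist H l z \<le> gdist S h x"
      using gdist_attach_new_le[of l h x] z hook by (simp add: fuse_def)
    finally show ?thesis
      using z by (simp add: latch_of_fuse seed_vertex_fuse)
  qed
next
  let ?f = "\<lambda>z. gdist G u (latch_of n z) + gdist S h (seed_vertex n h z)"
  \<comment> \<open>Along an old edge only the first summand varies, along an edge of a copy only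
    the second.\<close>
  have "?f y \<le> ?f x + 1" if "(x, y) \<in> adj H" for x y
    using that
  proof (cases rule: adj_attach_cases)
    case old
    then show ?thesis
      using gdist_adj[OF connected_G assms(1) old] adj_verts[OF old]
      by (simp add: latch_of_old seed_vertex_old)
  next
    case (new l p q)
    then show ?thesis
      using gdist_adj[OF connected_S hook new(2)] by (simp add: latch_of_fuse seed_vertex_fuse)
  qed
  moreover have "?f u = 0"
    using assms hook by (simp add: latch_of_old seed_vertex_old gdist_refl)
  ultimately show "?f z \<le> gdist H u z"
    using gdist_lower_bound[of H u z ?f] connected_attach assms by (auto simp: verts_attach)
qed

text \<open>Targets in the same copy, including the latch \<open>l\<close>, are reached within that
  copy; all others force a passage through \<open>l\<close>.\<close>

lemma gdist_attach_from_copy: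
  assumes l: "l \<in> L" and x: "x \<in> verts S" and z: "z \<in> verts H"
  shows "gdist H (fuse n h l x) z =
    (if latch_of n z = l then gdist S x (seed_vertex n h z)
     else gdist S x h + gdist G l (latch_of n z) + gdist S h (seed_vertex n h z))"
    (is "_ = ?f z")
proof (rule antisym)
  have v: "fuse n h l x \<in> verts H"
    using l x by (auto simp: verts_attach)
  have lG: "l \<in> verts G" and lH: "l \<in> verts H"
    using l latch_in by (auto simp: verts_attach)
  have fl: "fuse n h l h = l"
    by (simp add: fuse_def)
  show "gdist H (fuse n h l x) z \<le> ?f z"
  proof (cases "latch_of n z = l")
    case True
    then have "z = fuse n h l (seed_vertex n h z)"
      using fuse_latch_of[OF z] by simp
    then show ?thesis
      using gdist_attach_new_le[OF l x seed_vertex_in[OF z]] True by simp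
  next
    case False
    have "gdist H (fuse n h l x) z \<le> gdist H (fuse n h l x) l + gdist H l z"
      using connected_attach v lH z by (rule gdist_triangle)
    also have "gdist H (fuse n h l x) l \<le> gdist S x h"
      using gdist_attach_new_le[OF l x hook] by (simp add: fl)
    finally show ?thesis
      using False gdist_attach_from_old[OF lG z] by simp
  qed
  have "?f b \<le> ?f a + 1" if "(a, b) \<in> adj H" for a b
    using that
  proof (cases rule: adj_attach_cases)
    \<comment> \<open>On old vertices the two branches of \<open>?f\<close> fit together: at
      \<open>l\<close> itself the extra summands of the second branch vanish.\<close>
    case old
    then show ?thesis
      using gdist_adj[OF connected_G lG old] adj_verts[OF old] hook lG
      by (auto simp: latch_of_old seed_vertex_old gdist_refl)
  next
    \<comment> \<open>Both ends share the latch \<open>l'\<close>, so they fall under the same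
      branch of \<open>?f\<close>.\<close>
    case (new l' p q)
    then show ?thesis
      using gdist_adj[OF connected_S hook new(2)] gdist_adj[OF connected_S x new(2)]
      unfolding new(3,4) latch_of_fuse[OF new(1)] seed_vertex_fuse[OF new(1)] by simp
  qed
  moreover have "?f (fuse n h l x) = 0"
    using l x by (simp add: latch_of_fuse seed_vertex_fuse gdist_refl)
  ultimately show "?f z \<le> gdist H (fuse n h l x) z"
    using gdist_lower_bound[of H "fuse n h l x" z ?f] connected_attach v z by simp
qed

text \<open>A sandwich: mapping the seed to its copy and including the copy in \<open>H\<close>
  cannot increase distances, yet the distance in \<open>H\<close> already equals that in the
  seed.\<close>

lemma gdist_seed_copy:
  assumes l: "l \<in> L" and x: "x \<in> verts S"
  shows "gdist (seed_copy n S h l) (fuse n h l x) l = gdist S x h"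
proof (rule antisym)
  have fl: "fuse n h l h = l"
    by (simp add: fuse_def)
  have lG: "l \<in> verts G" and lH: "l \<in> verts H"
    using l latch_in by (auto simp: verts_attach)
  let ?C = "seed_copy n S h l"
  have v: "fuse n h l x \<in> verts ?C" and lC: "l \<in> verts ?C"
    using x hook by (auto simp: seed_copy_def fuse_def)
  have "gconnected ?C"
    unfolding gconnected_iff
  proof (intro ballI)
    fix a b assume "a \<in> verts ?C" "b \<in> verts ?C"
    then obtain p q where "p \<in> verts S" "q \<in> verts S" "a = fuse n h l p" "b = fuse n h l q"
      by (auto simp: seed_copy_def)
    then show "(a, b) \<in> (adj ?C)\<^sup>*"
      using connected_S rtrancl_image[of p q S "fuse n h l" ?C] adj_seed_copy
      by (auto simp: gconnected_iff)
  qed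
  then have "gdist H (fuse n h l x) l \<le> gdist ?C (fuse n h l x) l"
    using gdist_image_le[of ?C "fuse n h l x" l "\<lambda>z. z" H] v lC l x adj_seed_copy_attach
    by (auto simp: verts_attach)
  then show "gdist S x h \<le> gdist ?C (fuse n h l x) l"
    using gdist_attach_from_copy[OF l x lH] lG by (simp add: latch_of_old seed_vertex_old)
  show "gdist ?C (fuse n h l x) l \<le> gdist S x h"
    using gdist_image_le[of S x h "fuse n h l" ?C] connected_S x hook v adj_seed_copy
    by (simp add: fl)
qed

section \<open>Eccentricities in the enlarged network\<close>

lemma verts_nonempty: "verts S \<noteq> {}" "verts G \<noteq> {}" "finite (verts H)"
  using hook latches finite_attach by (auto simp: finite_multigraph_def)

text \<open>Old targets give the first term and copies the second. Every latch carries a full copy,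
  so the farthest latch and the farthest seed vertex can be combined.\<close>

lemma ecc_attach_old:
  assumes "u \<in> verts G"
  shows "ecc H u = max (ecc G u) (max_latch_dist G L u + ecc S h)"
proof (rule eccI[OF verts_nonempty(3)])
  fix w assume w: "w \<in> verts H"
  show "gdist H u w \<le> max (ecc G u) (max_latch_dist G L u + ecc S h)"
  proof (cases "w \<in> verts G")
    case True
    then show ?thesis
      using gdist_le_ecc[of G w u] finite_verts hook gdist_attach_from_old[OF assms w]
      by (simp add: latch_of_old seed_vertex_old gdist_refl)
  next
    case False
    then have "latch_of n w \<in> L"
      using w by (auto simp: verts_attach latch_of_fuse)
    then show ?thesis
      using gdist_le_max_latch_dist[of L "latch_of n w" G u]
        gdist_le_ecc[of S "seed_vertex n h w" h]
        seed_vertex_in[OF w] finite_verts gdist_attach_from_old[OF assms w]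
      by simp
  qed
next
  show "\<exists>w\<in>verts H. gdist H u w \<ge> max (ecc G u) (max_latch_dist G L u + ecc S h)"
  proof (rule ex_ge_max)
    obtain w where w: "w \<in> verts G" "ecc G u = gdist G u w"
      using ecc_witness finite_verts verts_nonempty by metis
    then have "w \<in> verts H"
      by (simp add: verts_attach)
    then show "\<exists>w\<in>verts H. gdist H u w \<ge> ecc G u"
      using w gdist_attach_from_old[OF assms] by (auto simp: latch_of_old intro!: bexI[of _ w])
  next
    obtain l where l: "l \<in> L" "max_latch_dist G L u = gdist G u l"
      using max_latch_dist_witness finite_verts latches by metis
    obtain x where x: "x \<in> verts S" "ecc S h = gdist S h x"
      using ecc_witness finite_verts verts_nonempty by metis
    have "fuse n h l x \<in> verts H"
      using l x by (auto simp: verts_attach)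
    then show "\<exists>w\<in>verts H. gdist H u w \<ge> max_latch_dist G L u + ecc S h"
      using l x gdist_attach_from_old[OF assms]
      by (auto simp: latch_of_fuse seed_vertex_fuse intro!: bexI[of _ "fuse n h l x"])
  qed
qed

text \<open>The three terms come from old targets, from targets in the same copy, and from targets
  in other copies, which exist only if there is a second latch.\<close>

lemma ecc_attach_copy:
  assumes l: "l \<in> L" and x: "x \<in> verts S"
  shows "ecc H (fuse n h l x) =
    max (gdist S x h + ecc G l)
      (max (ecc S x) ((gdist S x h + max_latch_dist G L l + ecc S h) * of_bool (card L > 1)))"
    (is "_ = max ?A (max ?B ?C)")
proof (rule eccI[OF verts_nonempty(3)])
  note D = gdist_attach_from_copy[OF l x]
  fix w assume w: "w \<in> verts H"
  show "gdist H (fuse n h l x) w \<le> max ?A (max ?B ?C)"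
  proof (cases "latch_of n w = l")
    case True
    then have "gdist H (fuse n h l x) w \<le> ?B"
      using gdist_le_ecc finite_verts D[OF w] seed_vertex_in[OF w] by simp
    then show ?thesis by simp
  next
    case ne: False
    show ?thesis
    proof (cases "w \<in> verts G")
      case True
      then have "gdist H (fuse n h l x) w \<le> ?A"
        using ne gdist_le_ecc[of G w l] finite_verts D[OF w] hook
        by (simp add: latch_of_old seed_vertex_old gdist_refl)
      then show ?thesis by simp
    next
      case False
      then have L: "latch_of n w \<in> L"
        using w by (auto simp: verts_attach latch_of_fuse)
      \<comment> \<open>A target in another copy exhibits a second latch, so the indicator is
        1.\<close>
      then have "card L \<ge> card {l, latch_of n w}"
        using l finite_verts by (intro card_mono) auto
      then have "card L > 1"
        using ne by simp
      then have "gdist H (fuse n h l x) w \<le> ?C"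
        using gdist_le_max_latch_dist[OF _ L, of G l] gdist_le_ecc[of S "seed_vertex n h w" h]
          seed_vertex_in[OF w] finite_verts D[OF w] ne by simp
      then show ?thesis by simp
    qed
  qed
next
  note D = gdist_attach_from_copy[OF l x]
  have lG: "l \<in> verts G"
    using l latch_in by auto
  show "\<exists>w\<in>verts H. gdist H (fuse n h l x) w \<ge> max ?A (max ?B ?C)"
  proof (intro ex_ge_max)
    obtain w where w: "w \<in> verts G" "ecc G l = gdist G l w"
      using ecc_witness finite_verts verts_nonempty by metis
    then have "w \<in> verts H"
      by (simp add: verts_attach)
    then show "\<exists>w\<in>verts H. gdist H (fuse n h l x) w \<ge> ?A"
      using w D lG by (auto simp: latch_of_old seed_vertex_old gdist_refl intro!: bexI[of _ w])
  next
    obtain y where y: "y \<in> verts S" "ecc S x = gdist S x y"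
      using ecc_witness finite_verts verts_nonempty by metis
    have "fuse n h l y \<in> verts H"
      using l y by (auto simp: verts_attach)
    then show "\<exists>w\<in>verts H. gdist H (fuse n h l x) w \<ge> ?B"
      using l y D
      by (auto simp: latch_of_fuse seed_vertex_fuse intro!: bexI[of _ "fuse n h l y"])
  next
    show "\<exists>w\<in>verts H. gdist H (fuse n h l x) w \<ge> ?C"
    proof (cases "card L > 1")
      case True
      obtain l1 where l1: "l1 \<in> L" "max_latch_dist G L l = gdist G l l1"
        using max_latch_dist_witness finite_verts latches by metis
      \<comment> \<open>If the maximum is attained only at the latch itself, it is 0, and any other latch does.\<close>
      obtain l2 where l2: "l2 \<in> L" "l2 \<noteq> l" "max_latch_dist G L l \<le> gdist G l l2"
      proof (cases "l1 = l")
        case True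
        have "L \<noteq> {l}"
          using \<open>card L > 1\<close> by auto
        then obtain l2 where "l2 \<in> L" "l2 \<noteq> l"
          using l by auto
        then show ?thesis
          using that True l1 lG by (simp add: gdist_refl)
      qed (use l1 that in simp)
      obtain y where y: "y \<in> verts S" "ecc S h = gdist S h y"
        using ecc_witness finite_verts verts_nonempty by metis
      have "fuse n h l2 y \<in> verts H"
        using l2 y by (auto simp: verts_attach)
      then show ?thesis
        using l2 y D True
        by (auto simp: latch_of_fuse seed_vertex_fuse intro!: bexI[of _ "fuse n h l2 y"])
    \<comment> \<open>With a single latch the indicator makes \<open>?C\<close> zero, and any vertex
      serves as witness.\<close>
    qed (use lG in \<open>auto simp: verts_attach\<close>)
  qed
qed

end

section \<open>The support of the network process\<close>

text \<open>The invariant of the process: what \<open>attachment\<close> asks of \<open>G\<close>,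
  and a vertex count equal to the bound on \<open>k n\<close> in
  \<open>building_sequence\<close>.\<close>

definition admissible ::
    "('s, 'e) multigraph \<Rightarrow> (nat \<Rightarrow> nat) \<Rightarrow> nat \<Rightarrow> ('s, 'e) network \<Rightarrow> bool" where
  "admissible S k n G \<longleftrightarrow> finite_multigraph G \<and> gconnected G \<and>
     (\<forall>m l x. Copy m l x \<in> verts G \<longrightarrow> m < n) \<and>
     (\<forall>m l e. Copy_link m l e \<in> edges G \<longrightarrow> m < n) \<and>
     card (verts G) = card (verts S) + (card (verts S) - 1) * (\<Sum>i<n. k i)"

lemma admissible_initial:
  assumes "seed S h"
  shows "admissible S k 0 (initial S)"
proof -
  have S: "finite_multigraph S" "gconnected S"
    using assms by (auto simp: seed_def)
  have adj: "(Orig x, Orig y) \<in> adj (initial S)" if xy: "(x, y) \<in> adj S" for x y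
  proof -
    obtain e where "x \<in> verts S" "y \<in> verts S" "e \<in> edges S" "ends S e = {x, y}"
      using xy by (auto simp: adj_def)
    then show ?thesis
      by (auto simp: adj_def initial_def intro!: bexI[of _ "Orig_link e"])
  qed
  have "(Orig x, Orig y) \<in> (adj (initial S))\<^sup>*" if "x \<in> verts S" "y \<in> verts S" for x y
    using S(2) that by (intro rtrancl_image[where f = Orig, OF _ adj]) (simp_all add: gconnected_iff)
  then have "gconnected (initial S)"
    by (auto simp: gconnected_iff initial_def)
  moreover have "finite_multigraph (initial S)"
    using S(1) by (auto simp: finite_multigraph_def initial_def card_image inj_on_def)
  ultimately show ?thesis
    by (auto simp: admissible_def initial_def card_image inj_on_def)
qed

text \<open>\<open>pmf_of_set\<close> has the expected support only for a finite nonempty set; the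
  vertex count together with the bound on \<open>k n\<close> supplies a set of latches.\<close>

lemma set_latch_pmf:
  assumes "building_sequence (card (verts S)) k" "admissible S k n G"
  shows "set_pmf (latch_pmf k n G) = {L. L \<subseteq> verts G \<and> card L = k n}"
proof -
  have "k n \<le> card (verts G)" and fin: "finite (verts G)"
    using assms by (auto simp: building_sequence_def admissible_def finite_multigraph_def)
  then obtain L where "L \<subseteq> verts G" "card L = k n"
    by (meson obtain_subset_with_card_n)
  then show ?thesis
    unfolding latch_pmf_def using fin by (intro set_pmf_of_set) auto
qed

lemma attachment_admissible:
  assumes "seed S h" "building_sequence (card (verts S)) k" "admissible S k n G"
    and "L \<in> set_pmf (latch_pmf k n G)"
  shows "attachment S h n G L"
proof -
  have "L \<subseteq> verts G" "card L = k n" "k n \<ge> 1"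
    using set_latch_pmf[OF assms(2,3)] assms(2,4) by (auto simp: building_sequence_def)
  moreover from this have "L \<noteq> {}"
    by auto
  ultimately show ?thesis
    using assms by (auto simp: attachment_def admissible_def)
qed

lemma admissible_network:
  assumes "seed S h" "building_sequence (card (verts S)) k" "G \<in> set_pmf (network_pmf S h k n)"
  shows "admissible S k n G"
  using assms(3)
proof (induction n arbitrary: G)
  case 0
  then show ?case
    using admissible_initial[OF assms(1)] by simp
next
  case (Suc n)
  then obtain G' L where G': "admissible S k n G'" and L: "L \<in> set_pmf (latch_pmf k n G')"
    and G: "G = attach n S h G' L"
    by auto
  interpret attachment S h n G' L
    using assms(1,2) G' L by (rule attachment_admissible)
  \<comment> \<open>This turns the increment of \<open>card_attach\<close> into the next term of the
    sum in \<open>admissible\<close>.\<close>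
  have "card L = k n"
    using L set_latch_pmf[OF assms(2) G'] by auto
  then show ?case
    using G' finite_attach connected_attach fresh_attach card_attach
    unfolding admissible_def G by (simp add: algebra_simps)
qed

section \<open>Conditioning on the network and its latches\<close>

lemma past_event_support:
  assumes "measure_pmf.prob (step_pmf S h k n) (past_event G L) > 0"
  shows "G \<in> set_pmf (network_pmf S h k n)" "L \<in> set_pmf (latch_pmf k n G)"
    and "set_pmf (step_pmf S h k n) \<inter> past_event G L \<noteq> {}"
proof -
  show ne: "set_pmf (step_pmf S h k n) \<inter> past_event G L \<noteq> {}"
    using assms measure_pmf_zero_iff[of "step_pmf S h k n" "past_event G L"] by fastforce
  then show "G \<in> set_pmf (network_pmf S h k n)" "L \<in> set_pmf (latch_pmf k n G)"
    by (auto simp: step_pmf_def past_event_def)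
qed

text \<open>On the support of \<open>step_pmf\<close> the third component is determined by the first
  two, so conditioning on these leaves a single value.\<close>

lemma cond_ecc_pmf_eq:
  assumes "measure_pmf.prob (step_pmf S h k (n - 1)) (past_event G L) > 0"
  shows "cond_ecc_pmf S h k n G L v = return_pmf (ecc (attach (n - 1) S h G L) v)"
proof -
  note ne = past_event_support(3)[OF assms]
  have "set_pmf (cond_ecc_pmf S h k n G L v) \<subseteq> {ecc (attach (n - 1) S h G L) v}"
    unfolding cond_ecc_pmf_def set_map_pmf set_cond_pmf[OF ne]
    by (auto simp: step_pmf_def past_event_def)
  then show ?thesis
    by (simp add: set_pmf_subset_singleton)
qed

text \<open>Positive probability of the past makes the conditional law meaningful. A latch is
  covered by both parts, the second with \<open>x = h\<close>, and the two values then
  agree.\<close>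

theorem theorem6p1:
  fixes S :: "('s, 'e) multigraph" and h :: 's and k :: "nat \<Rightarrow> nat" and n :: nat
    and G :: "('s, 'e) network" and L :: "'s node set" and l :: "nat \<Rightarrow> 's node" and v :: "'s node"
  assumes "seed S h"
    and "building_sequence (card (verts S)) k"
    and "n \<ge> 1"
    and "measure_pmf.prob (step_pmf S h k (n - 1)) (past_event G L) > 0"
    and "bij_betw l {1..k (n - 1)} L"
    and "v \<in> verts (attach (n - 1) S h G L)"
  shows "(v \<in> verts G \<longrightarrow>
      cond_ecc_pmf S h k n G L v =
        return_pmf (max (ecc G v) (max_latch_dist G L v + ecc S h))) \<and>
    (\<forall>i\<in>{1..k (n - 1)}. \<forall>x\<in>verts S. v = fuse (n - 1) h (l i) x \<longrightarrow>
      cond_ecc_pmf S h k n G L v =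
        return_pmf
          (max (gdist (seed_copy (n - 1) S h (l i)) v (l i) + ecc G (l i))
            (max (ecc S x)
              ((gdist (seed_copy (n - 1) S h (l i)) v (l i) + max_latch_dist G L (l i) + ecc S h)
                * of_bool (k (n - 1) > 1)))))"
proof -
  note supp = past_event_support[OF assms(4)]
  have "admissible S k (n - 1) G"
    using assms(1,2) supp(1) by (rule admissible_network)
  \<comment> \<open>The copies that turn G_(n-1) into G_n carry the stamp
    \<open>n - 1\<close>.\<close>
  then interpret attachment S h "n - 1" G L
    using attachment_admissible[OF assms(1,2) _ supp(2)] by simp
  have card: "card L = k (n - 1)"
    using bij_betw_same_card[OF assms(5)] by simp
  have latch: "l i \<in> L" if "i \<in> {1..k (n - 1)}" for i
    using bij_betwE[OF assms(5)] that by blast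
  show ?thesis
    unfolding cond_ecc_pmf_eq[OF assms(4)]
    using ecc_attach_old ecc_attach_copy[OF latch] gdist_seed_copy[OF latch] card by auto
qed

end
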